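(* A $D$-norm $\|\cdot\|_D$ on $\mathbb{R}^2$ is idempotent if and only if $\|\cdot\|_D\in\{\|\cdot\|_1,\|\cdot\|_\infty\}$.
   Context: A generator is a random vector $\bm{Z}=(Z_1,\dots,Z_d)$ with $Z_i\ge 0$ almost surely and $E(Z_i)=1$ for $1\le i\le d$. The $D$-norm on $\mathbb{R}^d$ generated by $\bm{Z}$ is $\|\bm{x}\|_D:=E\left(\max_{1\le i\le d}(|x_i|Z_i)\right)$, $\bm{x}\in\mathbb{R}^d$. A $D$-norm is a norm on $\mathbb{R}^d$ that arises in this way from some generator; the generator of a $D$-norm is not unique. For two $D$-norms $\|\cdot\|_{D^{(1)}}$, $\|\cdot\|_{D^{(2)}}$ on $\mathbb{R}^d$, their product $\|\cdot\|_{D^{(1)}D^{(2)}}$ is the $D$-norm generated by the componentwise product $\bm{Z}^{(1)}\bm{Z}^{(2)}$, where $\bm{Z}^{(1)}$, $\bm{Z}^{(2)}$ are independent generators of $\|\cdot\|_{D^{(1)}}$, $\|\cdot\|_{D^{(2)}}$; it does not depend on the choice of these independent generators. A $D$-norm is called idempotent if $\|\cdot\|_{D^2}:=\|\cdot\|_{DD}=\|\cdot\|_D$. Here $\|\bm{x}\|_1=\sum_{i}|x_i|$ and $\|\bm{x}\|_\infty=\max_i|x_i|$. *)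

theory Defs
  imports "HOL-Probability.Probability"
begin

definition generator :: "'a measure \<Rightarrow> ('a \<Rightarrow> real ^ 'n) \<Rightarrow> bool" where
  "generator M Z \<longleftrightarrow>
     prob_space M \<and> Z \<in> borel_measurable M \<and>
     (\<forall>i. AE \<omega> in M. 0 \<le> Z \<omega> $ i) \<and>
     (\<forall>i. integrable M (\<lambda>\<omega>. Z \<omega> $ i) \<and> (\<integral>\<omega>. Z \<omega> $ i \<partial>M) = 1)"

definition Dnorm :: "'a measure \<Rightarrow> ('a \<Rightarrow> real ^ 'n) \<Rightarrow> real ^ 'n \<Rightarrow> real" where
  "Dnorm M Z x = (\<integral>\<omega>. (MAX i. \<bar>x $ i\<bar> * Z \<omega> $ i) \<partial>M)"

text \<open>
  HOL does not allow quantifying over the type of the sample space, so the sample space is taken to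
  be \<open>\<real>\<^sup>n\<close>. This is no restriction: \<open>is_Dnorm_Dnorm\<close> below shows that every generator on any
  probability space yields a D-norm in this sense (pass to the law of the generator).
\<close>
definition is_Dnorm :: "(real ^ 'n \<Rightarrow> real) \<Rightarrow> bool" where
  "is_Dnorm N \<longleftrightarrow>
     (\<exists>(M :: (real ^ 'n) measure) (Z :: real ^ 'n \<Rightarrow> real ^ 'n). generator M Z \<and> N = Dnorm M Z)"

definition vec_mult :: "real ^ 'n \<Rightarrow> real ^ 'n \<Rightarrow> real ^ 'n" where
  "vec_mult z w = (\<chi> i. z $ i * w $ i)"

definition indep_generators :: "'a measure \<Rightarrow> ('a \<Rightarrow> real ^ 'n) \<Rightarrow> ('a \<Rightarrow> real ^ 'n) \<Rightarrow> bool" where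
  "indep_generators M Z1 Z2 \<longleftrightarrow>
     generator M Z1 \<and> generator M Z2 \<and> prob_space.indep_var M borel Z1 borel Z2"

text \<open>
  The sample space \<open>\<real>\<^sup>n \<times> \<real>\<^sup>n\<close> carries independent generators of any two D-norms. The description is
  proper for D-norms \<open>N1\<close> and \<open>N2\<close>, and \<open>Dnorm_product_eq\<close> below shows that independent generators
  on any probability space give the same product.
\<close>
definition Dnorm_product ::
    "(real ^ 'n \<Rightarrow> real) \<Rightarrow> (real ^ 'n \<Rightarrow> real) \<Rightarrow> real ^ 'n \<Rightarrow> real" where
  "Dnorm_product N1 N2 =
     (THE N. \<exists>(M :: ((real ^ 'n) \<times> (real ^ 'n)) measure) Z1 Z2.
        indep_generators M Z1 Z2 \<and> N1 = Dnorm M Z1 \<and> N2 = Dnorm M Z2 \<and>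
        N = Dnorm M (\<lambda>\<omega>. vec_mult (Z1 \<omega>) (Z2 \<omega>)))"

definition idempotent_Dnorm :: "(real ^ 'n \<Rightarrow> real) \<Rightarrow> bool" where
  "idempotent_Dnorm N \<longleftrightarrow> is_Dnorm N \<and> Dnorm_product N N = N"

definition norm_1 :: "real ^ 'n \<Rightarrow> real" where
  "norm_1 x = (\<Sum>i\<in>UNIV. \<bar>x $ i\<bar>)"

lemma infnorm_eq_MAX: "infnorm (x :: real ^ 'n) = (MAX i. \<bar>x $ i\<bar>)"
proof -
  have "(\<lambda>b. \<bar>x \<bullet> b\<bar>) ` Basis = range (\<lambda>i. \<bar>x $ i\<bar>)"
    by (force simp: Basis_vec_def inner_axis)
  then show ?thesis
    by (simp add: infnorm_Max)
qed


section \<open>Independence of the choice of sample space and generators\<close>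

lemma vec_mult_nth [simp]: "vec_mult z w $ i = z $ i * w $ i"
  by (simp add: vec_mult_def)

lemma vec_mult_commute: "vec_mult z w = vec_mult w z"
  by (simp add: vec_eq_iff mult.commute)

lemma borel_measurable_vec_nth' [measurable]:
  "(\<lambda>z :: real ^ 'n. z $ i) \<in> borel_measurable borel"
  by (intro borel_measurable_continuous_onI continuous_intros)

lemma borel_measurable_vec_mult:
  assumes [measurable]: "Z1 \<in> borel_measurable M" "Z2 \<in> borel_measurable M"
  shows "(\<lambda>\<omega>. vec_mult (Z1 \<omega>) (Z2 \<omega> :: real ^ 'n)) \<in> borel_measurable M"
proof -
  have "(\<lambda>p :: (real ^ 'n) \<times> (real ^ 'n). vec_mult (fst p) (snd p)) \<in> borel_measurable borel"
    unfolding vec_mult_def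
    by (intro borel_measurable_continuous_onI continuous_intros)
  moreover have "(\<lambda>\<omega>. (Z1 \<omega>, Z2 \<omega>)) \<in> borel_measurable M"
    unfolding borel_prod[symmetric] by measurable
  ultimately have "(\<lambda>\<omega>. vec_mult (fst (Z1 \<omega>, Z2 \<omega>)) (snd (Z1 \<omega>, Z2 \<omega>))) \<in> borel_measurable M"
    by (rule measurable_compose[rotated])
  then show ?thesis
    by simp
qed

lemma borel_measurable_MAX_mult [measurable]:
  "(\<lambda>z :: real ^ 'n. MAX i. \<bar>x $ i\<bar> * z $ i) \<in> borel_measurable borel"
  by (intro borel_measurable_Max) auto

lemma abs_MAX_le_sum:
  fixes f :: "'n :: finite \<Rightarrow> real"
  shows "\<bar>MAX i. f i\<bar> \<le> (\<Sum>i\<in>UNIV. \<bar>f i\<bar>)"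
proof -
  have "(MAX i. f i) \<in> range f"
    by (intro Max_in) auto
  then obtain i where "(MAX i. f i) = f i"
    by (rule rangeE)
  then show ?thesis
    using member_le_sum[of i UNIV "\<lambda>i. \<bar>f i\<bar>"] by simp
qed

lemma generator_distr:
  assumes f[measurable]: "f \<in> measurable M L" and Z[measurable]: "Z \<in> borel_measurable L"
  shows "generator (distr M L f) Z \<longleftrightarrow> prob_space (distr M L f) \<and>
     (\<forall>i. AE \<omega> in M. 0 \<le> Z (f \<omega>) $ i) \<and>
     (\<forall>i. integrable M (\<lambda>\<omega>. Z (f \<omega>) $ i) \<and> (\<integral>\<omega>. Z (f \<omega>) $ i \<partial>M) = 1)"
  unfolding generator_def
  by (simp add: AE_distr_iff integrable_distr_eq integral_distr)

lemma Dnorm_distr: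
  assumes f[measurable]: "f \<in> measurable M L" and Z[measurable]: "Z \<in> borel_measurable L"
  shows "Dnorm (distr M L f) Z = Dnorm M (\<lambda>\<omega>. Z (f \<omega>))"
  unfolding Dnorm_def by (intro ext integral_distr) measurable

lemma generator_law:
  assumes "generator M Z"
  shows "generator (distr M borel Z) (\<lambda>z. z)" "Dnorm (distr M borel Z) (\<lambda>z. z) = Dnorm M Z"
proof -
  have *: "Z \<in> borel_measurable M" "prob_space M"
    using assms by (auto simp: generator_def)
  then show "generator (distr M borel Z) (\<lambda>z. z)"
    using assms by (subst generator_distr) (auto simp: generator_def intro: prob_space.prob_space_distr)
  show "Dnorm (distr M borel Z) (\<lambda>z. z) = Dnorm M Z"
    using * by (subst Dnorm_distr) auto
qed

theorem is_Dnorm_Dnorm: "generator M Z \<Longrightarrow> is_Dnorm (Dnorm M Z)"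
  unfolding is_Dnorm_def
  by (intro exI[of _ "distr M borel Z"] exI[of _ "\<lambda>z. z"] conjI generator_law(2)[symmetric])
     (rule generator_law(1))

lemma indep_generators_product:
  assumes gen: "generator M Z" "generator L W"
  shows "indep_generators (M \<Otimes>\<^sub>M L) (\<lambda>\<omega>. Z (fst \<omega>)) (\<lambda>\<omega>. W (snd \<omega>))"
    and "Dnorm (M \<Otimes>\<^sub>M L) (\<lambda>\<omega>. Z (fst \<omega>)) = Dnorm M Z"
    and "Dnorm (M \<Otimes>\<^sub>M L) (\<lambda>\<omega>. W (snd \<omega>)) = Dnorm L W"
proof -
  interpret M: prob_space M using gen by (simp add: generator_def)
  interpret L: prob_space L using gen by (simp add: generator_def)
  interpret P: pair_prob_space M L ..
  have [measurable]: "Z \<in> borel_measurable M" "W \<in> borel_measurable L"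
    using gen by (auto simp: generator_def)
  have 1: "distr (M \<Otimes>\<^sub>M L) M fst = M"
    by (rule L.distr_pair_fst)
  have 2: "distr (M \<Otimes>\<^sub>M L) L snd = L"
  proof -
    have "distr (M \<Otimes>\<^sub>M L) L snd = distr (distr (L \<Otimes>\<^sub>M M) (M \<Otimes>\<^sub>M L) (\<lambda>(x, y). (y, x))) L snd"
      using P.distr_pair_swap by simp
    also have "\<dots> = distr (L \<Otimes>\<^sub>M M) L fst"
      by (subst distr_distr) (auto simp: comp_def case_prod_beta)
    also have "\<dots> = L"
      by (rule M.distr_pair_fst)
    finally show ?thesis .
  qed
  have g1: "generator (M \<Otimes>\<^sub>M L) (\<lambda>\<omega>. Z (fst \<omega>))"
    using gen(1) generator_distr[of fst "M \<Otimes>\<^sub>M L" M Z] unfolding 1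
    by (simp add: generator_def P.prob_space_axioms)
  have g2: "generator (M \<Otimes>\<^sub>M L) (\<lambda>\<omega>. W (snd \<omega>))"
    using gen(2) generator_distr[of snd "M \<Otimes>\<^sub>M L" L W] unfolding 2
    by (simp add: generator_def P.prob_space_axioms)
  have d1: "distr (M \<Otimes>\<^sub>M L) borel (\<lambda>\<omega>. Z (fst \<omega>)) = distr M borel Z"
    using distr_distr[of Z M borel fst "M \<Otimes>\<^sub>M L"] by (simp add: 1 comp_def)
  have d2: "distr (M \<Otimes>\<^sub>M L) borel (\<lambda>\<omega>. W (snd \<omega>)) = distr L borel W"
    using distr_distr[of W L borel snd "M \<Otimes>\<^sub>M L"] by (simp add: 2 comp_def)
  have "distr M borel Z \<Otimes>\<^sub>M distr L borel W =
      distr (M \<Otimes>\<^sub>M L) (borel \<Otimes>\<^sub>M borel) (\<lambda>(x, y). (Z x, W y))"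
    by (intro pair_measure_distr L.prob_space_distr prob_space_imp_sigma_finite) auto
  then have "P.indep_var borel (\<lambda>\<omega>. Z (fst \<omega>)) borel (\<lambda>\<omega>. W (snd \<omega>))"
    unfolding P.indep_var_distribution_eq by (simp add: d1 d2 case_prod_unfold)
  with g1 g2 show "indep_generators (M \<Otimes>\<^sub>M L) (\<lambda>\<omega>. Z (fst \<omega>)) (\<lambda>\<omega>. W (snd \<omega>))"
    by (simp add: indep_generators_def)
  show "Dnorm (M \<Otimes>\<^sub>M L) (\<lambda>\<omega>. Z (fst \<omega>)) = Dnorm M Z"
    using Dnorm_distr[of fst "M \<Otimes>\<^sub>M L" M Z] by (simp add: 1)
  show "Dnorm (M \<Otimes>\<^sub>M L) (\<lambda>\<omega>. W (snd \<omega>)) = Dnorm L W"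
    using Dnorm_distr[of snd "M \<Otimes>\<^sub>M L" L W] by (simp add: 2)
qed

lemma indep_generators_sym:
  assumes "indep_generators M Z1 Z2"
  shows "indep_generators M Z2 Z1"
proof -
  interpret prob_space M using assms by (simp add: indep_generators_def generator_def)
  interpret D1: prob_space "distr M borel Z1"
    using assms by (intro prob_space_distr) (simp add: indep_generators_def generator_def)
  interpret D2: prob_space "distr M borel Z2"
    using assms by (intro prob_space_distr) (simp add: indep_generators_def generator_def)
  interpret P: pair_prob_space "distr M borel Z2" "distr M borel Z1" ..
  have iv: "indep_var borel Z1 borel Z2"
    using assms by (simp add: indep_generators_def)
  then have [measurable]: "Z1 \<in> borel_measurable M" "Z2 \<in> borel_measurable M"
    by (auto simp: indep_var_distribution_eq)
  have eq: "distr M borel Z1 \<Otimes>\<^sub>M distr M borel Z2 = distr M (borel \<Otimes>\<^sub>M borel) (\<lambda>x. (Z1 x, Z2 x))"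
    using iv by (simp add: indep_var_distribution_eq)
  have "distr M borel Z2 \<Otimes>\<^sub>M distr M borel Z1 =
      distr (distr M borel Z1 \<Otimes>\<^sub>M distr M borel Z2) (borel \<Otimes>\<^sub>M borel) (\<lambda>(x, y). (y, x))"
    by (subst P.distr_pair_swap) (intro distr_cong sets_pair_measure_cong; simp)
  also have "\<dots> = distr M (borel \<Otimes>\<^sub>M borel) (\<lambda>x. (Z2 x, Z1 x))"
    unfolding eq by (subst distr_distr) (auto simp: comp_def)
  finally show ?thesis
    using assms by (auto simp: indep_generators_def indep_var_distribution_eq)
qed

lemma generator_vec_mult:
  assumes "indep_generators M Z1 Z2"
  shows "generator M (\<lambda>\<omega>. vec_mult (Z1 \<omega>) (Z2 \<omega>))"
proof -
  have g: "generator M Z1" "generator M Z2"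
    using assms by (auto simp: indep_generators_def)
  interpret prob_space M using g by (simp add: generator_def)
  have iv: "indep_var borel Z1 borel Z2"
    using assms by (simp add: indep_generators_def)
  have iv': "indep_var borel (\<lambda>\<omega>. Z1 \<omega> $ i) borel (\<lambda>\<omega>. Z2 \<omega> $ i)" for i
    using indep_var_compose[OF iv, of "\<lambda>z. z $ i" borel "\<lambda>z. z $ i" borel] by (simp add: comp_def)
  have ae: "AE \<omega> in M. 0 \<le> Z1 \<omega> $ i * Z2 \<omega> $ i" for i
  proof -
    have "AE \<omega> in M. 0 \<le> Z1 \<omega> $ i" "AE \<omega> in M. 0 \<le> Z2 \<omega> $ i"
      using g by (auto simp: generator_def)
    then show ?thesis by eventually_elim simp
  qed
  show ?thesis
    using g indep_var_integrable[OF iv'] indep_var_lebesgue_integral[OF iv'] ae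
    by (auto simp: generator_def prob_space_axioms intro: borel_measurable_vec_mult)
qed

lemma Dnorm_vec_mult_eq:
  assumes "indep_generators M Z1 Z2"
  shows "Dnorm M (\<lambda>\<omega>. vec_mult (Z1 \<omega>) (Z2 \<omega>)) x = (\<integral>\<omega>. Dnorm M Z2 (vec_mult x (Z1 \<omega>)) \<partial>M)"
proof -
  have g: "generator M Z1" "generator M Z2"
    using assms by (auto simp: indep_generators_def)
  interpret prob_space M using g by (simp add: generator_def)
  define P where "P = distr M borel Z1"
  define Q where "Q = distr M borel Z2"
  have iv: "indep_var borel Z1 borel Z2"
    using assms by (simp add: indep_generators_def)
  have [measurable]: "Z1 \<in> borel_measurable M" "Z2 \<in> borel_measurable M"
    using g by (auto simp: generator_def)
  interpret P: prob_space P unfolding P_def by (rule prob_space_distr) simp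
  interpret Q: prob_space Q unfolding Q_def by (rule prob_space_distr) simp
  interpret PQ: pair_prob_space P Q ..
  have eq: "P \<Otimes>\<^sub>M Q = distr M (borel \<Otimes>\<^sub>M borel) (\<lambda>x. (Z1 x, Z2 x))"
    using iv by (simp add: indep_var_distribution_eq P_def Q_def)
  define h where "h = (\<lambda>z w :: real ^ 'b. MAX i. \<bar>x $ i\<bar> * vec_mult z w $ i)"
  have [measurable]: "(\<lambda>p. h (fst p) (snd p)) \<in> borel_measurable (borel \<Otimes>\<^sub>M borel)"
    unfolding h_def
    by (intro measurable_compose[OF borel_measurable_vec_mult borel_measurable_MAX_mult]) auto
  have h_meas: "(\<lambda>\<omega>. h (Z1 \<omega>) (Z2 \<omega>)) \<in> borel_measurable M"
    unfolding h_def
    by (intro measurable_compose[OF borel_measurable_vec_mult borel_measurable_MAX_mult]) auto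
  have int: "integrable M (\<lambda>\<omega>. h (Z1 \<omega>) (Z2 \<omega>))"
  proof (rule Bochner_Integration.integrable_bound)
    show "integrable M (\<lambda>\<omega>. \<Sum>i\<in>UNIV. \<bar>\<bar>x $ i\<bar> * vec_mult (Z1 \<omega>) (Z2 \<omega>) $ i\<bar>)"
      using generator_vec_mult[OF assms] unfolding generator_def
      by (intro Bochner_Integration.integrable_sum integrable_abs integrable_mult_right) blast
    show "AE \<omega> in M. norm (h (Z1 \<omega>) (Z2 \<omega>))
        \<le> norm (\<Sum>i\<in>UNIV. \<bar>\<bar>x $ i\<bar> * vec_mult (Z1 \<omega>) (Z2 \<omega>) $ i\<bar>)"
    proof (rule AE_I2)
      fix \<omega>
      show "norm (h (Z1 \<omega>) (Z2 \<omega>)) \<le> norm (\<Sum>i\<in>UNIV. \<bar>\<bar>x $ i\<bar> * vec_mult (Z1 \<omega>) (Z2 \<omega>) $ i\<bar>)"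
        unfolding h_def real_norm_def by (rule order_trans[OF abs_MAX_le_sum abs_ge_self])
    qed
  qed (rule h_meas)
  have int': "integrable (P \<Otimes>\<^sub>M Q) (\<lambda>p. h (fst p) (snd p))"
    unfolding eq using int by (subst integrable_distr_eq) auto
  have meas1: "(\<lambda>z. \<integral>w. h z w \<partial>Q) \<in> borel_measurable borel"
  proof -
    have "(\<lambda>p. h (fst p) (snd p)) \<in> borel_measurable (borel \<Otimes>\<^sub>M Q)"
      by (simp add: Q_def cong: measurable_cong_sets)
    then show ?thesis
      by (intro Q.borel_measurable_lebesgue_integral) (simp add: case_prod_beta)
  qed
  have "Dnorm M (\<lambda>\<omega>. vec_mult (Z1 \<omega>) (Z2 \<omega>)) x = (\<integral>\<omega>. h (Z1 \<omega>) (Z2 \<omega>) \<partial>M)"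
    by (simp add: Dnorm_def h_def)
  also have "\<dots> = (\<integral>p. h (fst p) (snd p) \<partial>(P \<Otimes>\<^sub>M Q))"
    unfolding eq by (subst integral_distr) auto
  also have "\<dots> = (\<integral>z. \<integral>w. h z w \<partial>Q \<partial>P)"
    using PQ.integral_fst'[OF int'] by simp
  also have "\<dots> = (\<integral>\<omega>. (\<integral>w. h (Z1 \<omega>) w \<partial>Q) \<partial>M)"
    unfolding P_def by (rule integral_distr) (auto intro: meas1)
  also have "\<dots> = (\<integral>\<omega>. Dnorm M Z2 (vec_mult x (Z1 \<omega>)) \<partial>M)"
  proof (rule integral_cong_AE)
    have inner: "(\<integral>w. h z w \<partial>Q) = Dnorm M Z2 (vec_mult x z)" if "\<forall>i. 0 \<le> z $ i" for z
    proof -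
      have "h z w = (MAX i. \<bar>vec_mult x z $ i\<bar> * w $ i)" for w
        using that by (simp add: h_def abs_mult mult.assoc)
      then have "(\<integral>w. h z w \<partial>Q) = (\<integral>w. (MAX i. \<bar>vec_mult x z $ i\<bar> * w $ i) \<partial>Q)"
        by simp
      also have "\<dots> = Dnorm M Z2 (vec_mult x z)"
        unfolding Q_def Dnorm_def by (rule integral_distr) measurable
      finally show ?thesis .
    qed
    have "AE \<omega> in M. \<forall>i\<in>UNIV. 0 \<le> Z1 \<omega> $ i"
      using g by (intro AE_finite_allI) (auto simp: generator_def)
    then show "AE \<omega> in M. (\<integral>w. h (Z1 \<omega>) w \<partial>Q) = Dnorm M Z2 (vec_mult x (Z1 \<omega>))"
      by eventually_elim (simp add: inner)
    show "(\<lambda>\<omega>. \<integral>w. h (Z1 \<omega>) w \<partial>Q) \<in> borel_measurable M"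
      by (rule measurable_compose[OF _ meas1]) simp
    have "(\<lambda>p. MAX i. \<bar>vec_mult x (Z1 (fst p)) $ i\<bar> * Z2 (snd p) $ i)
        \<in> borel_measurable (M \<Otimes>\<^sub>M M)"
      unfolding vec_mult_nth by (intro borel_measurable_Max) auto
    then show "(\<lambda>\<omega>. Dnorm M Z2 (vec_mult x (Z1 \<omega>))) \<in> borel_measurable M"
      unfolding Dnorm_def by (intro borel_measurable_lebesgue_integral) (simp add: case_prod_beta)
  qed
  finally show ?thesis .
qed

theorem Dnorm_vec_mult_unique:
  assumes Z: "indep_generators M Z1 Z2" and W: "indep_generators L W1 W2"
    and eq: "Dnorm M Z1 = Dnorm L W1" "Dnorm M Z2 = Dnorm L W2"
  shows "Dnorm M (\<lambda>\<omega>. vec_mult (Z1 \<omega>) (Z2 \<omega>)) = Dnorm L (\<lambda>\<omega>. vec_mult (W1 \<omega>) (W2 \<omega>))"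
proof
  fix x
  have gZ: "generator M Z1" "generator M Z2" and gW: "generator L W1" "generator L W2"
    using Z W by (auto simp: indep_generators_def)
  interpret M: prob_space M using gZ by (simp add: generator_def)
  interpret L: prob_space L using gW by (simp add: generator_def)
  interpret P: pair_prob_space M L ..
  note hyb = indep_generators_product[OF gZ(1) gW(2)]
  let ?P = "M \<Otimes>\<^sub>M L"
  have m: "Z1 \<in> borel_measurable M" "Z2 \<in> borel_measurable M"
    "W1 \<in> borel_measurable L" "W2 \<in> borel_measurable L"
    using gZ gW by (auto simp: generator_def)
  have meas: "(\<lambda>\<omega>. Dnorm K V (vec_mult x (U \<omega>))) \<in> borel_measurable S"
    if "prob_space K" and [measurable]: "V \<in> borel_measurable K" "U \<in> borel_measurable S"
    for K :: "'k measure" and V and U :: "'s \<Rightarrow> real ^ 'b" and S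
  proof -
    interpret K: prob_space K by fact
    have "(\<lambda>p. MAX i. \<bar>vec_mult x (U (fst p)) $ i\<bar> * V (snd p) $ i)
        \<in> borel_measurable (S \<Otimes>\<^sub>M K)"
      unfolding vec_mult_nth by (intro borel_measurable_Max) auto
    then show ?thesis
      unfolding Dnorm_def by (intro K.borel_measurable_lebesgue_integral) (simp add: case_prod_beta)
  qed
  have fst: "(\<integral>\<omega>. f (fst \<omega>) \<partial>?P) = (\<integral>\<omega>. f \<omega> \<partial>M)" if "f \<in> borel_measurable M" for f :: "_ \<Rightarrow> real"
    using integral_distr[of fst ?P M f] that by (simp add: L.distr_pair_fst)
  have snd: "(\<integral>\<omega>. f (snd \<omega>) \<partial>?P) = (\<integral>\<omega>. f \<omega> \<partial>L)" if "f \<in> borel_measurable L" for f :: "_ \<Rightarrow> real"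
  proof -
    have "(\<integral>\<omega>. f (snd \<omega>) \<partial>?P) = (\<integral>\<omega>. f (fst \<omega>) \<partial>(L \<Otimes>\<^sub>M M))"
      using P.integral_product_swap[of "\<lambda>\<omega>. f (snd \<omega>)"] that by (simp add: case_prod_unfold)
    also have "\<dots> = (\<integral>\<omega>. f \<omega> \<partial>L)"
      using integral_distr[of fst "L \<Otimes>\<^sub>M M" L f] that by (simp add: M.distr_pair_fst)
    finally show ?thesis .
  qed
  let ?H = "Dnorm ?P (\<lambda>\<omega>. vec_mult (Z1 (fst \<omega>)) (W2 (snd \<omega>))) x"
  have "?H = (\<integral>\<omega>. Dnorm L W2 (vec_mult x (Z1 (fst \<omega>))) \<partial>?P)"
    using Dnorm_vec_mult_eq[OF hyb(1), of x] by (simp add: hyb)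
  also have "\<dots> = (\<integral>\<omega>. Dnorm L W2 (vec_mult x (Z1 \<omega>)) \<partial>M)"
    by (rule fst) (intro meas m L.prob_space_axioms)
  also have "\<dots> = Dnorm M (\<lambda>\<omega>. vec_mult (Z1 \<omega>) (Z2 \<omega>)) x"
    using Dnorm_vec_mult_eq[OF Z, of x] by (simp add: eq)
  finally have 1: "?H = Dnorm M (\<lambda>\<omega>. vec_mult (Z1 \<omega>) (Z2 \<omega>)) x" .
  have "?H = (\<integral>\<omega>. Dnorm M Z1 (vec_mult x (W2 (snd \<omega>))) \<partial>?P)"
    using Dnorm_vec_mult_eq[OF indep_generators_sym[OF hyb(1)], of x]
    by (simp add: hyb vec_mult_commute[of "W2 _"])
  also have "\<dots> = (\<integral>\<omega>. Dnorm M Z1 (vec_mult x (W2 \<omega>)) \<partial>L)"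
    by (rule snd) (intro meas m M.prob_space_axioms)
  also have "\<dots> = Dnorm L (\<lambda>\<omega>. vec_mult (W1 \<omega>) (W2 \<omega>)) x"
    using Dnorm_vec_mult_eq[OF indep_generators_sym[OF W], of x]
    by (simp add: eq vec_mult_commute[of "W2 _"])
  finally show "Dnorm M (\<lambda>\<omega>. vec_mult (Z1 \<omega>) (Z2 \<omega>)) x
      = Dnorm L (\<lambda>\<omega>. vec_mult (W1 \<omega>) (W2 \<omega>)) x"
    using 1 by simp
qed

theorem Dnorm_product_eq:
  fixes Z1 Z2 :: "'a \<Rightarrow> real ^ 'n"
  assumes "indep_generators M Z1 Z2"
  shows "Dnorm_product (Dnorm M Z1) (Dnorm M Z2) = Dnorm M (\<lambda>\<omega>. vec_mult (Z1 \<omega>) (Z2 \<omega>))"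
  unfolding Dnorm_product_def
proof (rule the_equality)
  let ?L = "distr M borel Z1 \<Otimes>\<^sub>M distr M borel Z2"
  have g: "generator M Z1" "generator M Z2"
    using assms by (auto simp: indep_generators_def)
  note l = generator_law[OF g(1)] generator_law[OF g(2)]
  note p = indep_generators_product[OF l(1) l(3)]
  have d: "Dnorm M Z1 = Dnorm ?L fst" "Dnorm M Z2 = Dnorm ?L snd"
    using p l by auto
  have i: "indep_generators ?L fst snd"
    using p(1) by simp
  show "\<exists>(L :: ((real ^ 'n) \<times> (real ^ 'n)) measure) W1 W2. indep_generators L W1 W2 \<and>
      Dnorm M Z1 = Dnorm L W1 \<and> Dnorm M Z2 = Dnorm L W2 \<and>
      Dnorm M (\<lambda>\<omega>. vec_mult (Z1 \<omega>) (Z2 \<omega>)) = Dnorm L (\<lambda>\<omega>. vec_mult (W1 \<omega>) (W2 \<omega>))"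
    using i d Dnorm_vec_mult_unique[OF assms i d]
    by (intro exI[of _ ?L] exI[of _ fst] exI[of _ snd]) simp
next
  fix N
  assume "\<exists>(L :: ((real ^ 'n) \<times> (real ^ 'n)) measure) W1 W2. indep_generators L W1 W2 \<and>
      Dnorm M Z1 = Dnorm L W1 \<and> Dnorm M Z2 = Dnorm L W2 \<and>
      N = Dnorm L (\<lambda>\<omega>. vec_mult (W1 \<omega>) (W2 \<omega>))"
  then obtain L :: "((real ^ 'n) \<times> (real ^ 'n)) measure" and W1 W2 where
      "indep_generators L W1 W2" "Dnorm M Z1 = Dnorm L W1" "Dnorm M Z2 = Dnorm L W2"
      "N = Dnorm L (\<lambda>\<omega>. vec_mult (W1 \<omega>) (W2 \<omega>))"
    by blast
  then show "N = Dnorm M (\<lambda>\<omega>. vec_mult (Z1 \<omega>) (Z2 \<omega>))"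
    by (simp add: Dnorm_vec_mult_unique[OF assms])
qed

theorem is_Dnorm_Dnorm_product:
  fixes N1 N2 :: "real ^ 'n \<Rightarrow> real"
  assumes "is_Dnorm N1" "is_Dnorm N2"
  shows "is_Dnorm (Dnorm_product N1 N2)"
proof -
  obtain M L :: "(real ^ 'n) measure" and Z W :: "real ^ 'n \<Rightarrow> real ^ 'n"
    where *: "generator M Z" "N1 = Dnorm M Z" "generator L W" "N2 = Dnorm L W"
    using assms unfolding is_Dnorm_def by blast
  note p = indep_generators_product[OF *(1,3)]
  show ?thesis
    using Dnorm_product_eq[OF p(1)] is_Dnorm_Dnorm[OF generator_vec_mult[OF p(1)]]
    by (simp add: p * )
qed

end

theory Submission
  imports Defs
begin

text \<open>
  Let \<open>N\<close> be generated by \<open>Z = (A, B)\<close> and put \<open>\<rho> = E \<surd>(AB)\<close>. Conditioning on one of the two factors,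
  idempotence says \<open>N x = E (N (x Z))\<close>. Starting from \<open>min a b \<le> \<surd>(ab)\<close>, which yields
  \<open>x\<^sub>1 + x\<^sub>2 - N x \<le> \<surd>(x\<^sub>1 x\<^sub>2)\<close> for nonnegative \<open>x\<close>, and substituting into this identity repeatedly,
  one gets \<open>x\<^sub>1 + x\<^sub>2 - N x \<le> \<rho>\<^sup>n \<surd>(x\<^sub>1 x\<^sub>2)\<close> for all \<open>n\<close>. As \<open>E (\<surd>A - \<surd>B)\<^sup>2 = 2 - 2 \<rho>\<close>, either \<open>\<rho> < 1\<close>
  and \<open>N\<close> is the 1-norm, or \<open>A = B\<close> almost surely and \<open>N\<close> is the maximum norm.
\<close>

section \<open>Integrability, and the product of a D-norm with itself\<close>

lemma MAX_2: "(MAX i::2. f i) = max (f 1) (f 2 :: real)"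
  by (simp add: UNIV_2)

lemma generator_AE_nonneg:
  assumes "generator M Z"
  shows "AE \<omega> in M. \<forall>i. 0 \<le> Z \<omega> $ i"
proof -
  have "AE \<omega> in M. \<forall>i\<in>UNIV. 0 \<le> Z \<omega> $ i"
    using assms by (intro AE_finite_allI) (auto simp: generator_def)
  then show ?thesis by simp
qed

lemma integrable_MAX_generator:
  assumes "generator M Z"
  shows "integrable M (\<lambda>\<omega>. MAX i. \<bar>x $ i\<bar> * Z \<omega> $ i)"
proof (rule Bochner_Integration.integrable_bound)
  have [measurable]: "Z \<in> borel_measurable M"
    using assms by (simp add: generator_def)
  show "(\<lambda>\<omega>. MAX i. \<bar>x $ i\<bar> * Z \<omega> $ i) \<in> borel_measurable M"
    by (intro borel_measurable_Max) auto
  show "integrable M (\<lambda>\<omega>. \<Sum>i\<in>UNIV. \<bar>\<bar>x $ i\<bar> * Z \<omega> $ i\<bar>)"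
    using assms unfolding generator_def
    by (intro Bochner_Integration.integrable_sum integrable_abs integrable_mult_right) blast
  show "AE \<omega> in M. norm (MAX i. \<bar>x $ i\<bar> * Z \<omega> $ i) \<le> norm (\<Sum>i\<in>UNIV. \<bar>\<bar>x $ i\<bar> * Z \<omega> $ i\<bar>)"
    unfolding real_norm_def by (intro AE_I2 order_trans[OF abs_MAX_le_sum abs_ge_self])
qed

text \<open>A maximum of nonnegative terms is at most their sum, and \<open>E (Z $ i) = 1\<close>.
  The bound supplies a dominating function for integrability and one half of the equality with
  \<open>norm_1\<close>.\<close>

lemma Dnorm_abs_le_norm_1:
  assumes "generator M Z"
  shows "\<bar>Dnorm M Z x\<bar> \<le> norm_1 x"
proof -
  have int: "integrable M (\<lambda>\<omega>. \<Sum>i\<in>UNIV. \<bar>x $ i\<bar> * Z \<omega> $ i)"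
    using assms unfolding generator_def
    by (intro Bochner_Integration.integrable_sum integrable_mult_right) blast
  have "\<bar>Dnorm M Z x\<bar> \<le> (\<integral>\<omega>. \<bar>MAX i. \<bar>x $ i\<bar> * Z \<omega> $ i\<bar> \<partial>M)"
    unfolding Dnorm_def by (rule integral_abs_bound)
  also have "\<dots> \<le> (\<integral>\<omega>. (\<Sum>i\<in>UNIV. \<bar>x $ i\<bar> * Z \<omega> $ i) \<partial>M)"
  proof (rule integral_mono_AE[OF integrable_abs[OF integrable_MAX_generator[OF assms]] int])
    show "AE \<omega> in M. \<bar>MAX i. \<bar>x $ i\<bar> * Z \<omega> $ i\<bar> \<le> (\<Sum>i\<in>UNIV. \<bar>x $ i\<bar> * Z \<omega> $ i)"
      using generator_AE_nonneg[OF assms]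
    proof eventually_elim
      case (elim \<omega>)
      then show ?case
        using abs_MAX_le_sum[of "\<lambda>i. \<bar>x $ i\<bar> * Z \<omega> $ i"] by (simp add: abs_mult)
    qed
  qed
  also have "\<dots> = norm_1 x"
    using assms by (simp add: generator_def norm_1_def)
  finally show ?thesis .
qed

lemma borel_measurable_Dnorm_vec_mult:
  assumes "generator M Z"
  shows "(\<lambda>\<omega>. Dnorm M Z (vec_mult x (Z \<omega>))) \<in> borel_measurable M"
proof -
  interpret prob_space M using assms by (simp add: generator_def)
  have [measurable]: "Z \<in> borel_measurable M"
    using assms by (simp add: generator_def)
  have "(\<lambda>p. MAX i. \<bar>vec_mult x (Z (fst p)) $ i\<bar> * Z (snd p) $ i) \<in> borel_measurable (M \<Otimes>\<^sub>M M)"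
    unfolding vec_mult_nth by (intro borel_measurable_Max) auto
  then show ?thesis
    unfolding Dnorm_def by (intro borel_measurable_lebesgue_integral) (simp add: case_prod_beta)
qed

lemma integrable_Dnorm_vec_mult:
  assumes "generator M Z"
  shows "integrable M (\<lambda>\<omega>. Dnorm M Z (vec_mult x (Z \<omega>)))"
proof (rule Bochner_Integration.integrable_bound[OF _ borel_measurable_Dnorm_vec_mult[OF assms]])
  show "integrable M (\<lambda>\<omega>. norm_1 (vec_mult x (Z \<omega>)))"
    using assms unfolding generator_def norm_1_def vec_mult_nth
    by (intro Bochner_Integration.integrable_sum integrable_abs integrable_mult_right) blast
  show "AE \<omega> in M. norm (Dnorm M Z (vec_mult x (Z \<omega>))) \<le> norm (norm_1 (vec_mult x (Z \<omega>)))"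
    unfolding real_norm_def by (intro AE_I2 order_trans[OF Dnorm_abs_le_norm_1[OF assms] abs_ge_self])
qed

text \<open>The two coordinate copies of \<open>Z\<close> on \<open>M \<Otimes>\<^sub>M M\<close>
  are independent. Conditioning on the first leaves an integrand in \<open>fst p\<close> alone,
  whose marginal is \<open>M\<close>.\<close>

lemma Dnorm_product_self:
  assumes "generator M Z"
  shows "Dnorm_product (Dnorm M Z) (Dnorm M Z) x = (\<integral>\<omega>. Dnorm M Z (vec_mult x (Z \<omega>)) \<partial>M)"
proof -
  interpret prob_space M using assms by (simp add: generator_def)
  note p = indep_generators_product[OF assms assms]
  have "Dnorm_product (Dnorm M Z) (Dnorm M Z) x
      = (\<integral>p. Dnorm M Z (vec_mult x (Z (fst p))) \<partial>(M \<Otimes>\<^sub>M M))"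
    using Dnorm_product_eq[OF p(1)] Dnorm_vec_mult_eq[OF p(1), of x] by (simp add: p(2,3))
  also have "\<dots> = (\<integral>\<omega>. Dnorm M Z (vec_mult x (Z \<omega>)) \<partial>M)"
    using integral_distr[OF measurable_fst borel_measurable_Dnorm_vec_mult[OF assms], of M]
    by (simp add: distr_pair_fst)
  finally show ?thesis .
qed

section \<open>Idempotence as an integral identity, and the two norms that satisfy it\<close>

lemma idempotent_Dnorm_iff:
  assumes "generator M Z"
  shows "idempotent_Dnorm (Dnorm M Z) \<longleftrightarrow>
    (\<forall>x. (\<integral>\<omega>. Dnorm M Z (vec_mult x (Z \<omega>)) \<partial>M) = Dnorm M Z x)"
  by (simp add: idempotent_Dnorm_def is_Dnorm_Dnorm[OF assms] fun_eq_iff Dnorm_product_self[OF assms])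

text \<open>For nonnegative \<open>Z\<close>, \<open>norm_1 (vec_mult x Z)\<close> is linear in
  \<open>Z\<close>, so only the means of the coordinates enter.\<close>

lemma idempotent_Dnorm_norm_1:
  assumes gen: "generator M Z" and N: "Dnorm M Z = norm_1"
  shows "idempotent_Dnorm (Dnorm M Z)"
  unfolding idempotent_Dnorm_iff[OF gen]
proof
  fix x
  have "(\<integral>\<omega>. norm_1 (vec_mult x (Z \<omega>)) \<partial>M) = (\<integral>\<omega>. (\<Sum>i\<in>UNIV. \<bar>x $ i\<bar> * Z \<omega> $ i) \<partial>M)"
  proof (rule integral_cong_AE)
    have [measurable]: "Z \<in> borel_measurable M"
      using gen by (simp add: generator_def)
    show "(\<lambda>\<omega>. norm_1 (vec_mult x (Z \<omega>))) \<in> borel_measurable M"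
      unfolding norm_1_def vec_mult_nth by measurable
    show "(\<lambda>\<omega>. \<Sum>i\<in>UNIV. \<bar>x $ i\<bar> * Z \<omega> $ i) \<in> borel_measurable M"
      by measurable
    show "AE \<omega> in M. norm_1 (vec_mult x (Z \<omega>)) = (\<Sum>i\<in>UNIV. \<bar>x $ i\<bar> * Z \<omega> $ i)"
      using generator_AE_nonneg[OF gen] by eventually_elim (simp add: norm_1_def abs_mult)
  qed
  also have "\<dots> = norm_1 x"
    using gen by (simp add: generator_def norm_1_def)
  finally show "(\<integral>\<omega>. Dnorm M Z (vec_mult x (Z \<omega>)) \<partial>M) = Dnorm M Z x"
    by (simp add: N)
qed

text \<open>Here \<open>Dnorm M Z (vec_mult x (Z \<omega>))\<close> is almost surely the very
  integrand that defines \<open>Dnorm M Z x\<close>.\<close>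

lemma idempotent_Dnorm_infnorm:
  assumes gen: "generator M Z" and N: "Dnorm M Z = infnorm"
  shows "idempotent_Dnorm (Dnorm M Z)"
  unfolding idempotent_Dnorm_iff[OF gen]
proof
  fix x
  have "(\<integral>\<omega>. Dnorm M Z (vec_mult x (Z \<omega>)) \<partial>M) = (\<integral>\<omega>. (MAX i. \<bar>x $ i\<bar> * Z \<omega> $ i) \<partial>M)"
  proof (rule integral_cong_AE[OF borel_measurable_Dnorm_vec_mult[OF gen]
        borel_measurable_integrable[OF integrable_MAX_generator[OF gen]]])
    show "AE \<omega> in M. Dnorm M Z (vec_mult x (Z \<omega>)) = (MAX i. \<bar>x $ i\<bar> * Z \<omega> $ i)"
      using generator_AE_nonneg[OF gen] by eventually_elim (simp add: N infnorm_eq_MAX abs_mult)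
  qed
  then show "(\<integral>\<omega>. Dnorm M Z (vec_mult x (Z \<omega>)) \<partial>M) = Dnorm M Z x"
    by (simp add: Dnorm_def)
qed

section \<open>Geometric means and the converse direction\<close>

lemma integrable_sqrt_mult:
  fixes f g :: "'a \<Rightarrow> real"
  assumes f: "integrable M f" "AE \<omega> in M. 0 \<le> f \<omega>" and g: "integrable M g" "AE \<omega> in M. 0 \<le> g \<omega>"
  shows "integrable M (\<lambda>\<omega>. sqrt (f \<omega> * g \<omega>))"
proof (rule Bochner_Integration.integrable_bound)
  show "integrable M (\<lambda>\<omega>. f \<omega> + g \<omega>)"
    using f g by simp
  show "(\<lambda>\<omega>. sqrt (f \<omega> * g \<omega>)) \<in> borel_measurable M"
    using f g by measurable
  show "AE \<omega> in M. norm (sqrt (f \<omega> * g \<omega>)) \<le> norm (f \<omega> + g \<omega>)"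
    using f(2) g(2)
  proof eventually_elim
    case (elim \<omega>)
    then show ?case
      using arith_geo_mean_sqrt[of "f \<omega>" "g \<omega>"] by simp
  qed
qed

text \<open>Since \<open>a + b - max a b = min a b\<close>, it suffices that the minimum is at most
  the geometric mean.\<close>

lemma max_ge_add_minus_sqrt:
  fixes a b :: real
  assumes "0 \<le> a" "0 \<le> b"
  shows "a + b - sqrt (a * b) \<le> max a b"
proof -
  have "min a b = sqrt (min a b * min a b)"
    using assms by simp
  also have "\<dots> \<le> sqrt (a * b)"
    using assms by (intro real_sqrt_le_mono mult_mono) auto
  finally show ?thesis by linarith
qed

text \<open>The geometric mean is multiplicative in the coordinates, so each integration against
  \<open>Z\<close> contributes one factor \<open>E (sqrt (Z $ 1 * Z $ 2))\<close>. The pointwise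
  bound on the maximum is itself integrated once, hence the exponent \<open>Suc n\<close>.\<close>

lemma idempotent_Dnorm_ge:
  fixes Z :: "'a \<Rightarrow> real ^ 2"
  assumes gen: "generator M Z" and idem: "idempotent_Dnorm (Dnorm M Z)"
  shows "norm_1 x - (\<integral>\<omega>. sqrt (Z \<omega> $ 1 * Z \<omega> $ 2) \<partial>M) ^ Suc n * sqrt \<bar>x $ 1 * x $ 2\<bar> \<le> Dnorm M Z x"
proof -
  define \<rho> where "\<rho> = (\<integral>\<omega>. sqrt (Z \<omega> $ 1 * Z \<omega> $ 2) \<partial>M)"
  have nn: "AE \<omega> in M. \<forall>i. 0 \<le> Z \<omega> $ i"
    by (rule generator_AE_nonneg[OF gen])
  have Zi: "integrable M (\<lambda>\<omega>. Z \<omega> $ i)" "(\<integral>\<omega>. Z \<omega> $ i \<partial>M) = 1" "AE \<omega> in M. 0 \<le> Z \<omega> $ i" for i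
    using gen by (auto simp: generator_def)
  note sq = integrable_sqrt_mult[OF Zi(1,3)[of 1] Zi(1,3)[of 2]]
  \<comment> \<open>For nonnegative \<open>Z \<omega>\<close> this is
    \<open>norm_1 y - c * sqrt \<bar>y $ 1 * y $ 2\<bar>\<close> at
    \<open>y = vec_mult x (Z \<omega>)\<close>. Integration replaces \<open>c\<close> by
    \<open>c * \<rho>\<close>.\<close>
  define h where "h c x \<omega> = \<bar>x $ 1\<bar> * Z \<omega> $ 1 + \<bar>x $ 2\<bar> * Z \<omega> $ 2
      - c * sqrt \<bar>x $ 1 * x $ 2\<bar> * sqrt (Z \<omega> $ 1 * Z \<omega> $ 2)" for c and x :: "real ^ 2" and \<omega>
  have h_int: "integrable M (h c x)" for c x
    unfolding h_def using Zi sq by simp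
  have h_eq: "(\<integral>\<omega>. h c x \<omega> \<partial>M) = norm_1 x - c * \<rho> * sqrt \<bar>x $ 1 * x $ 2\<bar>" for c x
    unfolding h_def using Zi sq by (simp add: norm_1_def UNIV_2 \<rho>_def)
  have step: "norm_1 x - c * \<rho> * sqrt \<bar>x $ 1 * x $ 2\<bar> \<le> (\<integral>\<omega>. f \<omega> \<partial>M)"
    if "integrable M f" "AE \<omega> in M. h c x \<omega> \<le> f \<omega>" for c x f
    using integral_mono_AE[OF h_int that] by (simp add: h_eq)
  show ?thesis
    unfolding \<rho>_def[symmetric]
  proof (induction n arbitrary: x)
    case 0
    have "norm_1 x - 1 * \<rho> * sqrt \<bar>x $ 1 * x $ 2\<bar> \<le> (\<integral>\<omega>. (MAX i. \<bar>x $ i\<bar> * Z \<omega> $ i) \<partial>M)"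
    proof (rule step[OF integrable_MAX_generator[OF gen]])
      show "AE \<omega> in M. h 1 x \<omega> \<le> (MAX i. \<bar>x $ i\<bar> * Z \<omega> $ i)"
        using nn
      proof eventually_elim
        case (elim \<omega>)
        then show ?case
          using max_ge_add_minus_sqrt[of "\<bar>x $ 1\<bar> * Z \<omega> $ 1" "\<bar>x $ 2\<bar> * Z \<omega> $ 2"]
          by (simp add: h_def MAX_2 abs_mult real_sqrt_mult ac_simps)
      qed
    qed
    then show ?case
      by (simp add: Dnorm_def)
  next
    case (Suc n)
    have "norm_1 x - \<rho> ^ Suc n * \<rho> * sqrt \<bar>x $ 1 * x $ 2\<bar>
        \<le> (\<integral>\<omega>. Dnorm M Z (vec_mult x (Z \<omega>)) \<partial>M)"
    proof (rule step[OF integrable_Dnorm_vec_mult[OF gen]])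
      \<comment> \<open>This is the induction hypothesis at the random point
        \<open>vec_mult x (Z \<omega>)\<close>.\<close>
      show "AE \<omega> in M. h (\<rho> ^ Suc n) x \<omega> \<le> Dnorm M Z (vec_mult x (Z \<omega>))"
        using nn
      proof eventually_elim
        case (elim \<omega>)
        then show ?case
          using Suc.IH[of "vec_mult x (Z \<omega>)"]
          by (simp add: h_def norm_1_def UNIV_2 abs_mult real_sqrt_mult ac_simps)
      qed
    qed
    \<comment> \<open>Idempotence turns the integral of the inner D-norm back into
      \<open>Dnorm M Z x\<close>.\<close>
    then show ?case
      using idem by (simp add: idempotent_Dnorm_iff[OF gen] ac_simps)
  qed
qed

lemma idempotent_Dnorm_cases:
  fixes Z :: "'a \<Rightarrow> real ^ 2"
  assumes gen: "generator M Z" and idem: "idempotent_Dnorm (Dnorm M Z)"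
  shows "Dnorm M Z = norm_1 \<or> Dnorm M Z = infnorm"
proof -
  define \<rho> where "\<rho> = (\<integral>\<omega>. sqrt (Z \<omega> $ 1 * Z \<omega> $ 2) \<partial>M)"
  have nn: "AE \<omega> in M. \<forall>i. 0 \<le> Z \<omega> $ i"
    by (rule generator_AE_nonneg[OF gen])
  have Zi: "integrable M (\<lambda>\<omega>. Z \<omega> $ i)" "(\<integral>\<omega>. Z \<omega> $ i \<partial>M) = 1" "AE \<omega> in M. 0 \<le> Z \<omega> $ i" for i
    using gen by (auto simp: generator_def)
  note sq = integrable_sqrt_mult[OF Zi(1,3)[of 1] Zi(1,3)[of 2]]
  \<comment> \<open>The square in \<open>q_sq\<close> multiplied out, so that its integral follows
    by linearity; the two forms agree where the coordinates are nonnegative.\<close>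
  define q where "q \<omega> = Z \<omega> $ 1 + Z \<omega> $ 2 - 2 * sqrt (Z \<omega> $ 1 * Z \<omega> $ 2)" for \<omega>
  have q_int: "integrable M q"
    unfolding q_def using Zi sq by simp
  have q_eq: "(\<integral>\<omega>. q \<omega> \<partial>M) = 2 - 2 * \<rho>"
    unfolding q_def using Zi sq by (simp add: \<rho>_def)
  have q_sq: "AE \<omega> in M. q \<omega> = (sqrt (Z \<omega> $ 1) - sqrt (Z \<omega> $ 2))\<^sup>2"
    using nn by eventually_elim (simp add: q_def power2_diff real_sqrt_mult)
  then have q_nn: "AE \<omega> in M. 0 \<le> q \<omega>"
    by eventually_elim simp
  have "0 \<le> \<rho>"
    unfolding \<rho>_def using nn by (intro integral_nonneg_AE) (auto elim: eventually_mono)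
  have "\<rho> \<le> 1"
    using integral_nonneg_AE[OF q_nn] by (simp add: q_eq)
  then consider "\<rho> < 1" | "\<rho> = 1"
    by linarith
  then show ?thesis
  proof cases
    case 1
    have "Dnorm M Z x = norm_1 x" for x
    proof (rule antisym)
      show "Dnorm M Z x \<le> norm_1 x"
        using Dnorm_abs_le_norm_1[OF gen, of x] by simp
      \<comment> \<open>As \<rho> < 1, the correction term in the lower bounds tends to 0.\<close>
      have "(\<lambda>n. norm_1 x - \<rho> ^ Suc n * sqrt \<bar>x $ 1 * x $ 2\<bar>)
          \<longlonglongrightarrow> norm_1 x - 0 * sqrt \<bar>x $ 1 * x $ 2\<bar>"
        using \<open>0 \<le> \<rho>\<close> 1 by (intro tendsto_intros LIMSEQ_Suc LIMSEQ_power_zero) simp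
      then show "norm_1 x \<le> Dnorm M Z x"
        using LIMSEQ_le_const2 idempotent_Dnorm_ge[OF gen idem, of x] unfolding \<rho>_def[symmetric]
        by fastforce
    qed
    then show ?thesis by auto
  next
    case 2
    have "AE \<omega> in M. q \<omega> = 0"
      using integral_nonneg_eq_0_iff_AE[OF q_int q_nn] by (simp add: q_eq 2)
    \<comment> \<open>A vanishing square forces equal square roots, hence equal coordinates; the
      maximum then factors as \<open>infnorm x * Z \<omega> $ 1\<close>.\<close>
    then have eq: "AE \<omega> in M. Z \<omega> $ 2 = Z \<omega> $ 1"
      using q_sq by eventually_elim simp
    have "Dnorm M Z x = infnorm x" for x
    proof -
      have "Dnorm M Z x = (\<integral>\<omega>. infnorm x * Z \<omega> $ 1 \<partial>M)"
        unfolding Dnorm_def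
      proof (rule integral_cong_AE[OF borel_measurable_integrable[OF integrable_MAX_generator[OF gen]]])
        show "(\<lambda>\<omega>. infnorm x * Z \<omega> $ 1) \<in> borel_measurable M"
          using Zi by measurable
        show "AE \<omega> in M. (MAX i. \<bar>x $ i\<bar> * Z \<omega> $ i) = infnorm x * Z \<omega> $ 1"
          using nn eq
          by eventually_elim (simp add: infnorm_eq_MAX MAX_2 max_mult_distrib_right)
      qed
      then show ?thesis
        using Zi by simp
    qed
    then show ?thesis by auto
  qed
qed

theorem proposition3p3:
  fixes N :: "real ^ 2 \<Rightarrow> real"
  assumes "is_Dnorm N"
  shows "idempotent_Dnorm N \<longleftrightarrow> N \<in> {norm_1, infnorm}"
proof -
  obtain M :: "(real ^ 2) measure" and Z where gen: "generator M Z" and N: "N = Dnorm M Z"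
    using assms unfolding is_Dnorm_def by blast
  show ?thesis
    unfolding N
    using idempotent_Dnorm_cases[OF gen] idempotent_Dnorm_norm_1[OF gen]
      idempotent_Dnorm_infnorm[OF gen]
    by blast
qed

end
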